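(* Let $g>0$, $\mu\ge0$, $M=[-\mu,\mu]$, and let $H$ be the operator on $l^2(\mathbf Z)$ given by $(Hf)_m=e^{-g}f_{m-1}+e^{g}f_{m+1}+V_mf_m$, where $V$ is a $(\mathbf Z,M)$ pseudo-ergodic potential. Then $\mathrm{Spec}(H)=E+[-\mu,\mu]$ whenever $\mu\ge e^g+e^{-g}$, where $E=\{e^{g+i\theta}+e^{-g-i\theta}:\theta\in[0,2\pi]\}$. Moreover $0\in\mathrm{Spec}(H)$ if and only if $\mu\ge e^g-e^{-g}$.
   Context: A potential $V:\mathbf Z\to M$ is $(\mathbf Z,M)$ pseudo-ergodic if for every $\varepsilon>0$, every finite $F\subset\mathbf Z$ and every $W:F\to M$ there is $k\in\mathbf Z$ with $|W_m-V_{m+k}|<\varepsilon$ for all $m\in F$. Sums of sets are Minkowski sums. *)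

theory Defs
  imports "HOL-Analysis.Analysis" "HOL-Library.Set_Algebras"
begin

definition ell2 :: "(int \<Rightarrow> complex) set" where
  "ell2 = {f. (\<lambda>m. (norm (f m))\<^sup>2) summable_on UNIV}"

definition ell2_norm :: "(int \<Rightarrow> complex) \<Rightarrow> real" where
  "ell2_norm f = sqrt (\<Sum>\<^sub>\<infinity>m. (norm (f m))\<^sup>2)"

text \<open>Operators on the Hilbert space are represented by functions on all sequences, of which
  only the values on \<open>ell2\<close> matter.\<close>

definition ell2_bounded_linear :: "((int \<Rightarrow> complex) \<Rightarrow> int \<Rightarrow> complex) \<Rightarrow> bool" where
  "ell2_bounded_linear T \<longleftrightarrow>
     (\<forall>f\<in>ell2. T f \<in> ell2) \<and>
     (\<forall>f\<in>ell2. \<forall>h\<in>ell2. T (\<lambda>m. f m + h m) = (\<lambda>m. T f m + T h m)) \<and>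
     (\<forall>c. \<forall>f\<in>ell2. T (\<lambda>m. c * f m) = (\<lambda>m. c * T f m)) \<and>
     (\<exists>C. \<forall>f\<in>ell2. ell2_norm (T f) \<le> C * ell2_norm f)"

text \<open>The spectrum of a bounded operator \<open>T\<close>: those \<open>z\<close> for which \<open>T - z I\<close> has no bounded
  two-sided inverse on \<open>ell2\<close>.\<close>

definition ell2_spectrum :: "((int \<Rightarrow> complex) \<Rightarrow> int \<Rightarrow> complex) \<Rightarrow> complex set" where
  "ell2_spectrum T = {z. \<not> (\<exists>R. ell2_bounded_linear R \<and>
     (\<forall>f\<in>ell2. R (\<lambda>m. T f m - z * f m) = f) \<and>
     (\<forall>f\<in>ell2. (\<lambda>m. T (R f) m - z * R f m) = f))}"

text \<open>A map \<open>W : F \<rightarrow> M\<close> is represented by a total function whose values outside \<open>F\<close> are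
  irrelevant.\<close>

definition pseudo_ergodic :: "complex set \<Rightarrow> (int \<Rightarrow> complex) \<Rightarrow> bool" where
  "pseudo_ergodic M V \<longleftrightarrow> range V \<subseteq> M \<and>
     (\<forall>\<epsilon>::real. \<epsilon> > 0 \<longrightarrow> (\<forall>F. finite F \<longrightarrow> (\<forall>W. (\<forall>m\<in>F. W m \<in> M) \<longrightarrow>
        (\<exists>k::int. \<forall>m\<in>F. norm (W m - V (m + k)) < \<epsilon>))))"

definition nsa_anderson :: "real \<Rightarrow> (int \<Rightarrow> complex) \<Rightarrow> (int \<Rightarrow> complex) \<Rightarrow> int \<Rightarrow> complex" where
  "nsa_anderson g V f = (\<lambda>m.
     of_real (exp (- g)) * f (m - 1) + of_real (exp g) * f (m + 1) + V m * f m)"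

definition ellipse_E :: "real \<Rightarrow> complex set" where
  "ellipse_E g = {exp (of_real g + \<i> * of_real \<theta>) + exp (- of_real g - \<i> * of_real \<theta>)
     | \<theta>::real. \<theta> \<in> {0..2 * pi}}"

end

theory Submission imports Defs begin

text \<open>Write \<open>a = exp g + exp (- g)\<close> and \<open>b = exp g - exp (- g)\<close>, and let \<open>M = [-\<mu>, \<mu>]\<close>.
  The set \<open>E\<close> is the ellipse with semi-axes \<open>a\<close> (real) and \<open>b\<close> (imaginary).

  Points enter the spectrum through a limit-operator principle
  (\<open>unimodular_solution_in_spectrum\<close>). If some potential \<open>W\<close> with values in \<open>M\<close> admits a
  solution \<open>u\<close> of the eigenvalue equation at \<open>z\<close> with \<open>|u| = 1\<close> everywhere, then
  pseudo-ergodicity makes \<open>V\<close> look like \<open>W\<close> on arbitrarily long intervals. Cutting \<open>u\<close> off to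
  such an interval of length \<open>n\<close> gives a vector of norm \<open>sqrt n\<close> that \<open>H - z\<close> sends to one of norm
  \<open>\<epsilon> sqrt n + O(1)\<close>, so \<open>H - z\<close> is not bounded below. Constant \<open>W\<close> with plane waves \<open>u\<close> gives
  \<open>E + M\<close>. The potential \<open>W\<close> alternating between \<open>b\<close> and \<open>- b\<close>, with the period-four solution
  \<open>1, -1, -1, 1\<close> at \<open>z = 0\<close>, shows \<open>0 \<in> Spec H\<close> as soon as \<open>b \<le> \<mu>\<close>.

  Points are excluded by finding \<open>B\<close> for which \<open>B (H - z)\<close> differs from the identity by a strict
  contraction (\<open>not_in_spectrum_preconditioned\<close>, a Neumann series). If \<open>\<mu> < b\<close>, the forward hopping
  term \<open>exp g\<close> dominates the rest of \<open>H\<close>, and the inverse of that term serves as \<open>B\<close> at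
  \<open>z = 0\<close>. If \<open>a \<le> \<mu>\<close>, translating the ellipse by \<open>M\<close> leaves no hole, so \<open>E + M\<close> is
  convex and contains the numerical range of \<open>H\<close>. A point \<open>z\<close> outside is then separated from the
  numerical range by a line with some normal \<open>\<nu>\<close> (\<open>separating_direction\<close>), \<open>cnj \<nu> (z - H)\<close> is
  strictly accretive, and a small multiple of \<open>- cnj \<nu>\<close> serves as \<open>B\<close>.\<close>

section \<open>Square-summable sequences\<close>

text \<open>Membership and norm are both controlled by the Euclidean norms of finite sections, so that
  inequalities in \<open>ell2\<close> reduce to finite-dimensional ones.\<close>

lemma ell2_finite_boundI:
  assumes "\<And>F. finite F \<Longrightarrow> L2_set (\<lambda>m. norm (f m)) F \<le> C"
  shows "f \<in> ell2" and "ell2_norm f \<le> C"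
proof -
  have C: "C \<ge> 0" using assms[of "{}"] by simp
  have b: "(\<Sum>m\<in>F. (norm (f m))\<^sup>2) \<le> C\<^sup>2" if "finite F" for F
    using assms[OF that] C unfolding L2_set_def by (metis sqrt_le_D)
  have s: "(\<lambda>m. (norm (f m))\<^sup>2) summable_on UNIV"
    by (rule nonneg_bdd_above_summable_on) (auto intro!: bdd_aboveI[of _ "C\<^sup>2"] b)
  then show "f \<in> ell2" by (simp add: ell2_def)
  have "(\<Sum>\<^sub>\<infinity>m. (norm (f m))\<^sup>2) \<le> C\<^sup>2"
    by (rule infsum_le_finite_sums[OF s]) (use b in auto)
  then show "ell2_norm f \<le> C" unfolding ell2_norm_def using C by (simp add: real_le_lsqrt)
qed

lemma L2_set_le_ell2_norm:
  assumes "f \<in> ell2" "finite F"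
  shows "L2_set (\<lambda>m. norm (f m)) F \<le> ell2_norm f"
  using assms unfolding L2_set_def ell2_norm_def ell2_def
  by (auto intro!: finite_sum_le_infsum)

lemma ell2_norm_nonneg: "0 \<le> ell2_norm f"
  unfolding ell2_norm_def by (simp add: infsum_nonneg)

lemma ell2_norm_power2: "(ell2_norm f)\<^sup>2 = (\<Sum>\<^sub>\<infinity>m. (norm (f m))\<^sup>2)"
  unfolding ell2_norm_def by (simp add: infsum_nonneg)

lemma norm_le_ell2_norm: "f \<in> ell2 \<Longrightarrow> norm (f m) \<le> ell2_norm f"
  using L2_set_le_ell2_norm[of f "{m}"] by simp

lemma ell2_norm_eq_0_imp: "f \<in> ell2 \<Longrightarrow> ell2_norm f \<le> 0 \<Longrightarrow> f = (\<lambda>_. 0)"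
  using norm_le_ell2_norm[of f] by (intro ext) (metis norm_le_zero_iff order_trans)

lemma ell2_add:
  assumes "f \<in> ell2" "h \<in> ell2"
  shows "(\<lambda>m. f m + h m) \<in> ell2" and "ell2_norm (\<lambda>m. f m + h m) \<le> ell2_norm f + ell2_norm h"
proof -
  have "L2_set (\<lambda>m. norm (f m + h m)) F \<le> ell2_norm f + ell2_norm h" if "finite F" for F
  proof -
    have "L2_set (\<lambda>m. norm (f m + h m)) F \<le> L2_set (\<lambda>m. norm (f m) + norm (h m)) F"
      by (intro L2_set_mono norm_triangle_ineq) auto
    also have "\<dots> \<le> L2_set (\<lambda>m. norm (f m)) F + L2_set (\<lambda>m. norm (h m)) F"
      by (rule L2_set_triangle_ineq)
    also have "\<dots> \<le> ell2_norm f + ell2_norm h"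
      using assms that by (intro add_mono L2_set_le_ell2_norm)
    finally show ?thesis .
  qed
  from ell2_finite_boundI[OF this]
  show "(\<lambda>m. f m + h m) \<in> ell2" and "ell2_norm (\<lambda>m. f m + h m) \<le> ell2_norm f + ell2_norm h"
    by auto
qed

lemma ell2_dominated:
  assumes "f \<in> ell2" "C \<ge> 0" "\<And>m. norm (h m) \<le> C * norm (f m)"
  shows "h \<in> ell2" and "ell2_norm h \<le> C * ell2_norm f"
proof -
  have "L2_set (\<lambda>m. norm (h m)) F \<le> C * ell2_norm f" if "finite F" for F
  proof -
    have "L2_set (\<lambda>m. norm (h m)) F \<le> L2_set (\<lambda>m. C * norm (f m)) F"
      by (intro L2_set_mono assms) auto
    also have "\<dots> = C * L2_set (\<lambda>m. norm (f m)) F"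
      using assms(2) by (simp add: L2_set_right_distrib)
    also have "\<dots> \<le> C * ell2_norm f"
      using assms that by (intro mult_left_mono L2_set_le_ell2_norm)
    finally show ?thesis .
  qed
  from ell2_finite_boundI[OF this] show "h \<in> ell2" and "ell2_norm h \<le> C * ell2_norm f" by auto
qed

lemma ell2_cmult:
  assumes "f \<in> ell2"
  shows "(\<lambda>m. c * f m) \<in> ell2" and "ell2_norm (\<lambda>m. c * f m) \<le> norm c * ell2_norm f"
  using ell2_dominated[OF assms, of "norm c" "\<lambda>m. c * f m"] by (auto simp: norm_mult)

lemma ell2_diff:
  assumes "f \<in> ell2" "h \<in> ell2"
  shows "(\<lambda>m. f m - h m) \<in> ell2" and "ell2_norm (\<lambda>m. f m - h m) \<le> ell2_norm f + ell2_norm h"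
  using ell2_add[OF assms(1) ell2_cmult(1)[OF assms(2), of "-1"]] ell2_cmult(2)[OF assms(2), of "-1"]
  by auto

lemma ell2_shift:
  assumes "f \<in> ell2"
  shows "(\<lambda>m. f (m + k)) \<in> ell2" and "ell2_norm (\<lambda>m. f (m + k)) = ell2_norm f"
proof -
  have bij: "bij_betw (\<lambda>m::int. m + k) UNIV UNIV"
    by (rule bij_betw_byWitness[of _ "\<lambda>m. m - k"]) auto
  show "(\<lambda>m. f (m + k)) \<in> ell2"
    using assms summable_on_reindex_bij_betw[OF bij, of "\<lambda>m. (norm (f m))\<^sup>2"] by (simp add: ell2_def)
  show "ell2_norm (\<lambda>m. f (m + k)) = ell2_norm f"
    using infsum_reindex_bij_betw[OF bij, of "\<lambda>m. (norm (f m))\<^sup>2"] by (simp add: ell2_norm_def)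
qed

lemma ell2_zero: "(\<lambda>_. 0) \<in> ell2" "ell2_norm (\<lambda>_. 0) = 0"
  by (auto simp: ell2_def ell2_norm_def)

lemma ell2_finite_support:
  assumes "finite A" "C \<ge> 0" "\<And>m. m \<in> A \<Longrightarrow> norm (f m) \<le> C" "\<And>m. m \<notin> A \<Longrightarrow> f m = 0"
  shows "f \<in> ell2" and "ell2_norm f \<le> C * sqrt (card A)"
proof -
  have "L2_set (\<lambda>m. norm (f m)) F \<le> C * sqrt (card A)" if "finite F" for F
  proof -
    have "(\<Sum>m\<in>F. (norm (f m))\<^sup>2) = (\<Sum>m\<in>F \<inter> A. (norm (f m))\<^sup>2)"
      using that assms(4) by (intro sum.mono_neutral_right) auto
    also have "\<dots> \<le> (\<Sum>m\<in>A. (norm (f m))\<^sup>2)"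
      using assms(1) by (intro sum_mono2) auto
    also have "\<dots> \<le> of_nat (card A) * C\<^sup>2"
      using assms by (intro sum_bounded_above power_mono) auto
    finally have "sqrt (\<Sum>m\<in>F. (norm (f m))\<^sup>2) \<le> sqrt (of_nat (card A) * C\<^sup>2)" by simp
    then show ?thesis using assms(2) by (simp add: L2_set_def real_sqrt_mult mult.commute)
  qed
  from ell2_finite_boundI[OF this] show "f \<in> ell2" and "ell2_norm f \<le> C * sqrt (card A)" by auto
qed

text \<open>A form of Fatou's lemma. It takes the place of completeness: the Neumann series below
  converges pointwise, and this puts its sum back into \<open>ell2\<close> with a norm bound.\<close>

lemma ell2_pointwise_limit:
  assumes "\<And>n. X n \<in> ell2" "\<And>n. ell2_norm (X n) \<le> C" "\<And>m. (\<lambda>n. X n m) \<longlonglongrightarrow> f m"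
  shows "f \<in> ell2" and "ell2_norm f \<le> C"
proof -
  have "L2_set (\<lambda>m. norm (f m)) F \<le> C" if "finite F" for F
  proof (rule LIMSEQ_le_const2)
    show "(\<lambda>n. L2_set (\<lambda>m. norm (X n m)) F) \<longlonglongrightarrow> L2_set (\<lambda>m. norm (f m)) F"
      unfolding L2_set_def by (intro tendsto_intros assms)
    show "\<exists>N. \<forall>n\<ge>N. L2_set (\<lambda>m. norm (X n m)) F \<le> C"
      using L2_set_le_ell2_norm[OF assms(1) that] assms(2) order_trans by blast
  qed
  from ell2_finite_boundI[OF this] show "f \<in> ell2" and "ell2_norm f \<le> C" by auto
qed

lemma ell2_inner_summable:
  assumes "f \<in> ell2" "h \<in> ell2"
  shows "(\<lambda>m. Re (f m * cnj (h m))) summable_on UNIV"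
proof -
  have "(\<lambda>m. (norm (f m))\<^sup>2 + (norm (h m))\<^sup>2) summable_on UNIV"
    using assms by (intro summable_on_add) (auto simp: ell2_def)
  then have "(\<lambda>m. norm (Re (f m * cnj (h m)))) summable_on UNIV"
  proof (rule summable_on_comparison_test)
    fix m
    have "\<bar>Re (f m * cnj (h m))\<bar> \<le> norm (f m) * norm (h m)"
      using abs_Re_le_cmod[of "f m * cnj (h m)"] by (simp add: norm_mult)
    also have "\<dots> \<le> (norm (f m))\<^sup>2 + (norm (h m))\<^sup>2"
      using sum_squares_bound[of "norm (f m)" "norm (h m)"]
        mult_nonneg_nonneg[OF norm_ge_zero[of "f m"] norm_ge_zero[of "h m"]] by linarith
    finally show "norm (Re (f m * cnj (h m))) \<le> (norm (f m))\<^sup>2 + (norm (h m))\<^sup>2" by simp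
  qed simp
  then show ?thesis by (rule abs_summable_summable)
qed

section \<open>Invertibility by Neumann series, and approximate eigenvectors\<close>

lemma ell2_bounded_linearD:
  assumes "ell2_bounded_linear T"
  shows "f \<in> ell2 \<Longrightarrow> T f \<in> ell2"
    and "f \<in> ell2 \<Longrightarrow> h \<in> ell2 \<Longrightarrow> T (\<lambda>m. f m + h m) = (\<lambda>m. T f m + T h m)"
    and "f \<in> ell2 \<Longrightarrow> T (\<lambda>m. c * f m) = (\<lambda>m. c * T f m)"
    and "f \<in> ell2 \<Longrightarrow> h \<in> ell2 \<Longrightarrow> T (\<lambda>m. f m - h m) = (\<lambda>m. T f m - T h m)"
proof -
  show *: "f \<in> ell2 \<Longrightarrow> T f \<in> ell2"
    "f \<in> ell2 \<Longrightarrow> h \<in> ell2 \<Longrightarrow> T (\<lambda>m. f m + h m) = (\<lambda>m. T f m + T h m)"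
    "f \<in> ell2 \<Longrightarrow> T (\<lambda>m. c * f m) = (\<lambda>m. c * T f m)" for f h c
    using assms unfolding ell2_bounded_linear_def by auto
  show "f \<in> ell2 \<Longrightarrow> h \<in> ell2 \<Longrightarrow> T (\<lambda>m. f m - h m) = (\<lambda>m. T f m - T h m)"
    using *(2)[of f "\<lambda>m. - 1 * h m"] *(3)[of h "- 1"] ell2_cmult(1)[of h "-1"] by simp
qed

text \<open>The Neumann series \<open>\<Sum>i. K\<^sup>i h\<close> solves \<open>x - K x = h\<close>. Each coordinate converges absolutely, and
  continuity of \<open>K\<close> under pointwise convergence, which holds for every operator of finite range on
  the lattice, allows the limit to be taken coordinate by coordinate in
  \<open>K (S n) = S (n + 1) - h\<close> for the partial sums \<open>S n\<close>.\<close>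

lemma contraction_solvable:
  assumes lin: "ell2_bounded_linear K"
    and q: "0 \<le> q" "q < 1" "\<And>f. f \<in> ell2 \<Longrightarrow> ell2_norm (K f) \<le> q * ell2_norm f"
    and cont: "\<And>X f m. (\<And>j. (\<lambda>n. X n j) \<longlonglongrightarrow> f j) \<Longrightarrow> (\<lambda>n. K (X n) m) \<longlonglongrightarrow> K f m"
    and h: "h \<in> ell2"
  shows "\<exists>x\<in>ell2. (\<lambda>m. x m - K x m) = h"
proof -
  define P where "P n = (K ^^ n) h" for n
  have P: "P n \<in> ell2 \<and> ell2_norm (P n) \<le> q ^ n * ell2_norm h" for n
  proof (induction n)
    case 0 then show ?case using h by (simp add: P_def)
  next
    case (Suc n)
    have "ell2_norm (K (P n)) \<le> q * (q ^ n * ell2_norm h)"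
      using q(3)[of "P n"] Suc q(1) by (meson mult_left_mono order_trans)
    then show ?case using Suc ell2_bounded_linearD(1)[OF lin] by (simp add: P_def mult.assoc)
  qed
  define S where "S n m = (\<Sum>i<n. P i m)" for n m
  have S_Suc: "S (Suc n) = (\<lambda>m. S n m + P n m)" for n by (auto simp: S_def)
  have S: "S n \<in> ell2 \<and> ell2_norm (S n) \<le> (\<Sum>i<n. q ^ i * ell2_norm h)" for n
  proof (induction n)
    case 0 then show ?case using ell2_zero by (simp add: S_def[abs_def])
  next
    case (Suc n)
    then show ?case using ell2_add[of "S n" "P n"] P[of n] by (auto simp: S_Suc)
  qed
  have geo: "(\<Sum>i<n. q ^ i * ell2_norm h) \<le> ell2_norm h / (1 - q)" for n
  proof -
    have "(\<Sum>i<n. q ^ i) \<le> (\<Sum>i. q ^ i)"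
      using q by (intro sum_le_suminf summable_geometric) auto
    also have "\<dots> = 1 / (1 - q)" using q by (intro suminf_geometric) auto
    finally show ?thesis
      using mult_right_mono[OF _ ell2_norm_nonneg[of h]] by (fastforce simp: sum_distrib_right)
  qed
  have KS: "K (S n) = (\<lambda>m. S (Suc n) m - h m)" for n
  proof (induction n)
    case 0
    have "K (\<lambda>_. 0) = (\<lambda>_. 0)" using ell2_bounded_linearD(3)[OF lin ell2_zero(1), of 0] by simp
    then show ?case by (simp add: S_def[abs_def] P_def)
  next
    case (Suc n)
    have "K (S (Suc n)) = (\<lambda>m. K (S n) m + K (P n) m)"
      unfolding S_Suc[of n] using S P by (intro ell2_bounded_linearD(2)[OF lin]) auto
    then show ?case by (auto simp: Suc S_Suc[of "Suc n"] P_def)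
  qed
  define x where "x m = (\<Sum>i. P i m)" for m
  have lim: "(\<lambda>n. S n m) \<longlonglongrightarrow> x m" for m
  proof -
    have "summable (\<lambda>i. q ^ i * ell2_norm h)"
      using q by (intro summable_mult2 summable_geometric) auto
    then have "summable (\<lambda>i. P i m)"
      by (rule summable_comparison_test'[where N = 0])
         (use P norm_le_ell2_norm order_trans in blast)
    then show ?thesis unfolding x_def S_def by (rule summable_LIMSEQ)
  qed
  have x: "x \<in> ell2"
    by (rule ell2_pointwise_limit[of S "ell2_norm h / (1 - q)"])
       (use S geo lim order_trans in blast)+
  have "x m - K x m = h m" for m
  proof -
    have "(\<lambda>n. K (S n) m) \<longlonglongrightarrow> K x m" by (rule cont) (rule lim)
    moreover have "(\<lambda>n. K (S n) m) \<longlonglongrightarrow> x m - h m"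
      unfolding KS by (intro tendsto_intros LIMSEQ_Suc lim)
    ultimately have "K x m = x m - h m" by (rule LIMSEQ_unique)
    then show ?thesis by simp
  qed
  then show ?thesis using x by auto
qed

text \<open>The lower bound gives injectivity of \<open>T - z\<close> and boundedness of its inverse; linearity of the
  inverse then follows from uniqueness of solutions.\<close>

lemma not_in_spectrumI:
  assumes lin: "ell2_bounded_linear T"
    and surj: "\<And>h. h \<in> ell2 \<Longrightarrow> \<exists>x\<in>ell2. (\<lambda>m. T x m - z * x m) = h"
    and below: "\<And>x. x \<in> ell2 \<Longrightarrow> ell2_norm x \<le> C * ell2_norm (\<lambda>m. T x m - z * x m)"
  shows "z \<notin> ell2_spectrum T"
proof -
  define A where "A x = (\<lambda>m. T x m - z * x m)" for x
  note T = ell2_bounded_linearD[OF lin]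
  have A_add: "A (\<lambda>m. f m + h m) = (\<lambda>m. A f m + A h m)" if "f \<in> ell2" "h \<in> ell2" for f h
    using T(2)[OF that] by (auto simp: A_def algebra_simps)
  have A_cmult: "A (\<lambda>m. c * f m) = (\<lambda>m. c * A f m)" if "f \<in> ell2" for f c
    using T(3)[OF that] by (auto simp: A_def algebra_simps)
  have A_diff: "A (\<lambda>m. f m - h m) = (\<lambda>m. A f m - A h m)" if "f \<in> ell2" "h \<in> ell2" for f h
    using T(4)[OF that] by (auto simp: A_def algebra_simps)
  have A_ell2: "A f \<in> ell2" if "f \<in> ell2" for f
    unfolding A_def using that T(1) ell2_cmult ell2_diff by simp
  have inj: "f = h" if "f \<in> ell2" "h \<in> ell2" "A f = A h" for f h
  proof -
    have "ell2_norm (\<lambda>m. f m - h m) \<le> 0"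
      using below[OF ell2_diff(1)[OF that(1,2)], folded A_def]
      unfolding A_diff[OF that(1,2)] that(3) by (simp add: ell2_zero)
    from ell2_norm_eq_0_imp[OF ell2_diff(1)[OF that(1,2)] this] show ?thesis
      by (metis ext eq_iff_diff_eq_0)
  qed
  define R where "R h = (SOME x. x \<in> ell2 \<and> A x = h)" for h
  have R: "R h \<in> ell2 \<and> A (R h) = h" if "h \<in> ell2" for h
  proof -
    have "\<exists>x. x \<in> ell2 \<and> A x = h" using surj[OF that] by (auto simp: A_def)
    from someI_ex[OF this] show ?thesis unfolding R_def .
  qed
  have "ell2_bounded_linear R"
    unfolding ell2_bounded_linear_def
  proof (intro conjI ballI allI exI)
    fix f h c assume f: "f \<in> ell2"
    show "R f \<in> ell2" using R f by auto
    show "R (\<lambda>m. c * f m) = (\<lambda>m. c * R f m)"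
      by (rule inj) (simp_all add: R f ell2_cmult A_cmult)
    show "ell2_norm (R f) \<le> C * ell2_norm f"
      using below[of "R f"] R[OF f] by (simp add: A_def)
    assume h: "h \<in> ell2"
    show "R (\<lambda>m. f m + h m) = (\<lambda>m. R f m + R h m)"
      by (rule inj) (simp_all add: R f h ell2_add A_add)
  qed
  moreover have "R (A f) = f" if "f \<in> ell2" for f
    by (rule inj) (simp_all add: R A_ell2 that)
  moreover have "A (R f) = f" if "f \<in> ell2" for f using R that by simp
  ultimately have "\<exists>R. ell2_bounded_linear R \<and> (\<forall>f\<in>ell2. R (A f) = f) \<and> (\<forall>f\<in>ell2. A (R f) = f)"
    by blast
  then show ?thesis unfolding ell2_spectrum_def A_def by simp
qed

text \<open>With \<open>K = 1 - B (T - z)\<close>, the equation \<open>(T - z) x = h\<close> becomes \<open>x - K x = B h\<close>, injectivity of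
  \<open>B\<close> allowing the passage back. The contraction bound on \<open>K\<close> also bounds \<open>T - z\<close> from below.\<close>

lemma not_in_spectrum_preconditioned:
  assumes T: "ell2_bounded_linear T" and B: "ell2_bounded_linear B"
    and inj: "\<And>f. f \<in> ell2 \<Longrightarrow> B f = (\<lambda>_. 0) \<Longrightarrow> f = (\<lambda>_. 0)"
    and cont: "\<And>X f m. (\<And>j. (\<lambda>n. X n j) \<longlonglongrightarrow> f j) \<Longrightarrow>
       (\<lambda>n. B (\<lambda>m. T (X n) m - z * X n m) m) \<longlonglongrightarrow> B (\<lambda>m. T f m - z * f m) m"
    and q: "0 \<le> q" "q < 1"
    and contr: "\<And>f. f \<in> ell2 \<Longrightarrow>
       ell2_norm (\<lambda>m. f m - B (\<lambda>m. T f m - z * f m) m) \<le> q * ell2_norm f"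
  shows "z \<notin> ell2_spectrum T"
proof -
  define A where "A x = (\<lambda>m. T x m - z * x m)" for x
  define K where "K f = (\<lambda>m. f m - B (A f) m)" for f
  note Tl = ell2_bounded_linearD[OF T] and Bl = ell2_bounded_linearD[OF B]
  have A_ell2: "A f \<in> ell2" if "f \<in> ell2" for f
    unfolding A_def using that Tl(1) ell2_cmult ell2_diff by simp
  have K_ell2: "K f \<in> ell2" if "f \<in> ell2" for f
    unfolding K_def using that A_ell2 Bl(1) ell2_diff by simp
  have Kl: "ell2_bounded_linear K"
    unfolding ell2_bounded_linear_def
  proof (intro conjI ballI allI exI)
    fix f h c assume f: "f \<in> ell2"
    show "K f \<in> ell2" using K_ell2 f by auto
    have "A (\<lambda>m. c * f m) = (\<lambda>m. c * A f m)"
      using Tl(3)[OF f] by (auto simp: A_def algebra_simps)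
    then show "K (\<lambda>m. c * f m) = (\<lambda>m. c * K f m)"
      using Bl(3)[OF A_ell2[OF f]] by (auto simp: K_def algebra_simps)
    show "ell2_norm (K f) \<le> q * ell2_norm f"
      using contr[OF f] by (simp add: A_def K_def)
    assume h: "h \<in> ell2"
    have "A (\<lambda>m. f m + h m) = (\<lambda>m. A f m + A h m)"
      using Tl(2)[OF f h] by (auto simp: A_def algebra_simps)
    then show "K (\<lambda>m. f m + h m) = (\<lambda>m. K f m + K h m)"
      using Bl(2)[OF A_ell2[OF f] A_ell2[OF h]] by (auto simp: K_def algebra_simps)
  qed
  obtain C where C: "\<And>f. f \<in> ell2 \<Longrightarrow> ell2_norm (B f) \<le> C * ell2_norm f"
    using B unfolding ell2_bounded_linear_def by blast
  show ?thesis
  proof (rule not_in_spectrumI[OF T])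
    fix h assume h: "h \<in> ell2"
    have "\<exists>x\<in>ell2. (\<lambda>m. x m - K x m) = B h"
    proof (rule contraction_solvable[OF Kl q])
      show "ell2_norm (K f) \<le> q * ell2_norm f" if "f \<in> ell2" for f
        using contr[OF that] by (simp add: A_def K_def)
      show "(\<lambda>n. K (X n) m) \<longlonglongrightarrow> K f m" if "\<And>j. (\<lambda>n. X n j) \<longlonglongrightarrow> f j" for X f m
        unfolding K_def A_def by (intro tendsto_diff that cont)
    qed (rule Bl(1)[OF h])
    then obtain x where x: "x \<in> ell2" "B (A x) = B h" by (auto simp: K_def)
    have "B (\<lambda>m. A x m - h m) = (\<lambda>_. 0)"
      using Bl(4)[OF A_ell2[OF x(1)] h] x(2) by simp
    then have "(\<lambda>m. A x m - h m) = (\<lambda>_. 0)"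
      using inj ell2_diff(1)[OF A_ell2[OF x(1)] h] by blast
    then have "A x = h" by (metis ext eq_iff_diff_eq_0)
    then show "\<exists>x\<in>ell2. (\<lambda>m. T x m - z * x m) = h" using x(1) by (auto simp: A_def)
  next
    fix x assume x: "x \<in> ell2"
    have "ell2_norm x \<le> ell2_norm (K x) + ell2_norm (B (A x))"
      using ell2_add(2)[OF K_ell2[OF x] Bl(1)[OF A_ell2[OF x]]] by (simp add: K_def)
    also have "\<dots> \<le> q * ell2_norm x + C * ell2_norm (A x)"
      using contr[OF x] C[OF A_ell2[OF x]] by (intro add_mono) (auto simp: K_def A_def)
    finally have "(1 - q) * ell2_norm x \<le> C * ell2_norm (A x)" by (simp add: algebra_simps)
    then show "ell2_norm x \<le> C / (1 - q) * ell2_norm (\<lambda>m. T x m - z * x m)"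
      using q by (simp add: A_def field_simps)
  qed
qed

lemma in_spectrumI:
  assumes "\<And>C. \<exists>f\<in>ell2. (\<lambda>m. T f m - z * f m) \<in> ell2 \<and>
              C * ell2_norm (\<lambda>m. T f m - z * f m) < ell2_norm f"
  shows "z \<in> ell2_spectrum T"
proof (rule ccontr)
  assume "z \<notin> ell2_spectrum T"
  then obtain R where R: "ell2_bounded_linear R" "\<forall>f\<in>ell2. R (\<lambda>m. T f m - z * f m) = f"
    unfolding ell2_spectrum_def by auto
  from R(1) obtain C where C: "\<forall>f\<in>ell2. ell2_norm (R f) \<le> C * ell2_norm f"
    unfolding ell2_bounded_linear_def by blast
  obtain f where f: "f \<in> ell2" "(\<lambda>m. T f m - z * f m) \<in> ell2"
      "C * ell2_norm (\<lambda>m. T f m - z * f m) < ell2_norm f"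
    using assms[of C] by blast
  have "ell2_norm f \<le> C * ell2_norm (\<lambda>m. T f m - z * f m)"
    using C[rule_format, OF f(2)] R(2)[rule_format, OF f(1)] by simp
  with f(3) show False by simp
qed

section \<open>Boundedness of the Hamiltonian\<close>

lemma ell2_tridiagonal:
  assumes "f \<in> ell2" "C \<ge> 0" "\<And>m. norm (d m) \<le> C"
  shows "(\<lambda>m. a * f (m - 1) + b * f (m + 1) + d m * f m) \<in> ell2"
    and "ell2_norm (\<lambda>m. a * f (m - 1) + b * f (m + 1) + d m * f m) \<le> (norm a + norm b + C) * ell2_norm f"
proof -
  have 1: "(\<lambda>m. a * f (m - 1)) \<in> ell2" "ell2_norm (\<lambda>m. a * f (m - 1)) \<le> norm a * ell2_norm f"
    using ell2_cmult[OF ell2_shift(1)[OF assms(1), of "-1"], of a] ell2_shift(2)[OF assms(1), of "-1"] by auto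
  have 2: "(\<lambda>m. b * f (m + 1)) \<in> ell2" "ell2_norm (\<lambda>m. b * f (m + 1)) \<le> norm b * ell2_norm f"
    using ell2_cmult[OF ell2_shift(1)[OF assms(1), of "1"], of b] ell2_shift(2)[OF assms(1), of "1"] by auto
  have 3: "(\<lambda>m. d m * f m) \<in> ell2" "ell2_norm (\<lambda>m. d m * f m) \<le> C * ell2_norm f"
    using ell2_dominated[OF assms(1,2), of "\<lambda>m. d m * f m"] assms(3)
    by (auto simp: norm_mult mult_right_mono)
  note 12 = ell2_add[OF 1(1) 2(1)]
  note 123 = ell2_add[OF 12(1) 3(1)]
  show "(\<lambda>m. a * f (m - 1) + b * f (m + 1) + d m * f m) \<in> ell2" by (rule 123(1))
  show "ell2_norm (\<lambda>m. a * f (m - 1) + b * f (m + 1) + d m * f m) \<le> (norm a + norm b + C) * ell2_norm f"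
    using 1(2) 2(2) 3(2) 12(2) 123(2) by (simp add: algebra_simps)
qed

lemma nsa_anderson_bounded_linear:
  assumes "\<And>m. norm (V m) \<le> \<mu>"
  shows "ell2_bounded_linear (nsa_anderson g V)"
proof -
  have "\<mu> \<ge> 0" using assms[of 0] norm_ge_zero order_trans by blast
  note t = ell2_tridiagonal[OF _ this assms]
  show ?thesis unfolding ell2_bounded_linear_def
  proof (intro conjI ballI allI exI)
    show "nsa_anderson g V f \<in> ell2" if "f \<in> ell2" for f
      unfolding nsa_anderson_def by (rule t(1)[OF that])
    show "ell2_norm (nsa_anderson g V f) \<le>
        (norm (of_real (exp (- g)) :: complex) + norm (of_real (exp g) :: complex) + \<mu>) * ell2_norm f"
      if "f \<in> ell2" for f
      unfolding nsa_anderson_def by (rule t(2)[OF that])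
  qed (auto simp: nsa_anderson_def algebra_simps)
qed

section \<open>Points of the spectrum from bounded solutions\<close>

text \<open>The residual of the cut-off solution has three parts: the mismatch of the potentials, which is at
  most \<open>\<epsilon>\<close> on an interval of length \<open>n\<close>, and the two hopping terms acting on the jumps of the cut-off,
  each supported on two sites.\<close>

lemma unimodular_solution_in_spectrum:
  assumes pe: "pseudo_ergodic M V" and W: "\<And>m. W m \<in> M"
    and u: "\<And>m. norm (u m) = 1"
    and eig: "\<And>m. nsa_anderson g W u m = z * u m"
  shows "z \<in> ell2_spectrum (nsa_anderson g V)"
proof (rule in_spectrumI)
  fix C0 :: real
  define C where "C = \<bar>C0\<bar> + 1"
  define D where "D = exp (- g) * sqrt 2 + exp g * sqrt 2"
  have C: "C > 0" "C0 \<le> C" by (auto simp: C_def)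
  have D: "D > 0" unfolding D_def by (intro add_pos_pos) auto
  obtain n :: nat where n: "(2 * C * D)\<^sup>2 < real n" using reals_Archimedean2 by blast
  have n0: "n > 0" using n by (metis of_nat_0 neq0_conv not_less zero_le_power2)
  define N where "N = int n"
  \<comment> \<open>With this \<open>\<epsilon>\<close>, the mismatch uses up half of \<open>sqrt n\<close>; the choice of \<open>n\<close> keeps \<open>C * D\<close> below the
    other half, \<open>D\<close> being the contribution of the ends.\<close>
  define \<epsilon> where "\<epsilon> = 1 / (2 * C)"
  have \<epsilon>: "\<epsilon> > 0" using C by (simp add: \<epsilon>_def)
  obtain k where k: "\<And>m. m \<in> {0..<N} \<Longrightarrow> norm (W m - V (m + k)) < \<epsilon>"
    using pe \<epsilon> W unfolding pseudo_ergodic_def by (meson finite_atLeastLessThan_int)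
  \<comment> \<open>The cut-off to the interval on which \<open>V\<close> imitates the translate of \<open>W\<close>.\<close>
  define s where "s j = (if j \<in> {k..<k+N} then 1 else 0 :: complex)" for j
  define f where "f j = s j * u (j - k)" for j
  define p0 where "p0 j = (V j - W (j - k)) * f j" for j
  define p1 where "p1 j = of_real (exp (- g)) * (s (j - 1) - s j) * u (j - 1 - k)" for j
  define p2 where "p2 j = of_real (exp g) * (s (j + 1) - s j) * u (j + 1 - k)" for j
  define r where "r = (\<lambda>m. nsa_anderson g V f m - z * f m)"
  have r: "r = (\<lambda>j. p0 j + p1 j + p2 j)"
  proof
    fix j
    have "z * f j = s j * nsa_anderson g W u (j - k)" by (simp add: eig f_def)
    then show "r j = p0 j + p1 j + p2 j"
      by (simp add: r_def p0_def p1_def p2_def f_def nsa_anderson_def algebra_simps)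
  qed
  have p0: "p0 \<in> ell2" "ell2_norm p0 \<le> \<epsilon> * sqrt n"
  proof -
    have "norm (p0 j) \<le> \<epsilon>" if "j \<in> {k..<k+N}" for j
      using k[of "j - k"] that u by (simp add: p0_def f_def s_def norm_mult norm_minus_commute)
    moreover have "p0 j = 0" if "j \<notin> {k..<k+N}" for j
      using that by (auto simp: p0_def f_def s_def)
    ultimately show "p0 \<in> ell2" "ell2_norm p0 \<le> \<epsilon> * sqrt n"
      using ell2_finite_support[of "{k..<k+N}" \<epsilon> p0] \<epsilon> by (auto simp: N_def)
  qed
  have p1: "p1 \<in> ell2" "ell2_norm p1 \<le> exp (- g) * sqrt 2"
  proof -
    have "norm (p1 j) \<le> exp (- g)" for j
      using u by (simp add: p1_def norm_mult s_def)
    moreover have "p1 j = 0" if "j \<notin> {k, k+N}" for j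
      using that by (auto simp: p1_def s_def)
    ultimately show "p1 \<in> ell2" "ell2_norm p1 \<le> exp (- g) * sqrt 2"
      using ell2_finite_support[of "{k,k+N}" "exp (- g)" p1] n0 by (auto simp: N_def)
  qed
  have p2: "p2 \<in> ell2" "ell2_norm p2 \<le> exp g * sqrt 2"
  proof -
    have "norm (p2 j) \<le> exp g" for j
      using u by (simp add: p2_def norm_mult s_def)
    moreover have "p2 j = 0" if "j \<notin> {k-1, k+N-1}" for j
      using that by (auto simp: p2_def s_def)
    ultimately show "p2 \<in> ell2" "ell2_norm p2 \<le> exp g * sqrt 2"
      using ell2_finite_support[of "{k-1,k+N-1}" "exp g" p2] n0 by (auto simp: N_def)
  qed
  note p01 = ell2_add[OF p0(1) p1(1)]
  note p012 = ell2_add[OF p01(1) p2(1)]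
  have f: "f \<in> ell2"
    by (rule ell2_finite_support[of "{k..<k+N}" 1]) (use u in \<open>auto simp: f_def s_def norm_mult\<close>)
  have "L2_set (\<lambda>m. norm (f m)) {k..<k+N} = L2_set (\<lambda>m. 1) {k..<k+N}"
    by (rule L2_set_cong) (auto simp: f_def s_def u)
  then have "sqrt n \<le> ell2_norm f"
    using L2_set_le_ell2_norm[OF f, of "{k..<k+N}"] by (simp add: L2_set_constant N_def)
  moreover have "C0 * ell2_norm r < sqrt n"
  proof -
    have "2 * C * D < sqrt n" using n C D by (intro real_less_rsqrt) auto
    have "C0 * ell2_norm r \<le> C * ell2_norm r" using C ell2_norm_nonneg by (intro mult_right_mono) auto
    also have "\<dots> \<le> C * (\<epsilon> * sqrt n + D)"
      using p0 p1 p2 p01 p012 C unfolding r D_def by (intro mult_left_mono) auto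
    also have "\<dots> = sqrt n / 2 + C * D" using C by (simp add: \<epsilon>_def field_simps)
    also have "\<dots> < sqrt n" using \<open>2 * C * D < sqrt n\<close> by simp
    finally show ?thesis .
  qed
  ultimately show "\<exists>f\<in>ell2. (\<lambda>m. nsa_anderson g V f m - z * f m) \<in> ell2 \<and>
      C0 * ell2_norm (\<lambda>m. nsa_anderson g V f m - z * f m) < ell2_norm f"
    using f p012(1) unfolding r[symmetric] by (intro bexI[of _ f]) (auto simp: r_def[symmetric])
qed

lemma ellipse_plus_range_subset_spectrum:
  assumes pe: "pseudo_ergodic M V"
  shows "ellipse_E g + M \<subseteq> ell2_spectrum (nsa_anderson g V)"
proof
  fix z assume "z \<in> ellipse_E g + M"
  then obtain \<theta> c where z: "z = exp (of_real g + \<i> * of_real \<theta>) + exp (- of_real g - \<i> * of_real \<theta>) + c"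
    and c: "c \<in> M"
    by (auto simp: ellipse_E_def elim!: set_plus_elim)
  define u where "u m = cis (\<theta> * of_int m)" for m
  show "z \<in> ell2_spectrum (nsa_anderson g V)"
  proof (rule unimodular_solution_in_spectrum[OF pe, of "\<lambda>_. c" u])
    fix m
    have "u (m - 1) = cis (- \<theta>) * u m" "u (m + 1) = cis \<theta> * u m"
      by (auto simp: u_def cis_mult algebra_simps)
    moreover have "exp (of_real g + \<i> * of_real \<theta>) = of_real (exp g) * cis \<theta>"
      "exp (- of_real g - \<i> * of_real \<theta>) = of_real (exp (- g)) * cis (- \<theta>)"
      by (simp_all add: cis_conv_exp exp_add[symmetric] exp_of_real[symmetric])
    ultimately show "nsa_anderson g (\<lambda>_. c) u m = z * u m"
      by (simp add: nsa_anderson_def z algebra_simps)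
  qed (auto simp: u_def c)
qed

text \<open>The potential that equals \<open>exp g - exp (- g)\<close> on even sites and its negative on odd sites has the
  solution \<open>1, -1, -1, 1\<close> of period four at energy zero: shifting by two sites changes its sign, so
  the two hopping terms combine to \<open>(exp g - exp (- g)) * u (m + 1)\<close>, and \<open>u (m + 1)\<close> is \<open>- u m\<close> for
  even \<open>m\<close> and \<open>u m\<close> for odd \<open>m\<close>.\<close>

lemma zero_in_spectrum:
  assumes pe: "pseudo_ergodic M V"
    and c: "of_real (exp g - exp (- g)) \<in> M" "of_real (- (exp g - exp (- g))) \<in> M"
  shows "0 \<in> ell2_spectrum (nsa_anderson g V)"
proof (rule unimodular_solution_in_spectrum[OF pe])
  define W :: "int \<Rightarrow> complex" where
    "W m = of_real (if even m then exp g - exp (- g) else - (exp g - exp (- g)))" for m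
  define u :: "int \<Rightarrow> complex" where "u m = (if m mod 4 = 0 \<or> m mod 4 = 3 then 1 else - 1)" for m
  show "W m \<in> M" for m using c by (auto simp: W_def)
  show "norm (u m) = 1" for m by (simp add: u_def)
  show "nsa_anderson g W u m = 0 * u m" for m
  proof -
    have r: "m mod 4 \<in> {0,1,2,3}" by auto
    have e: "even m \<longleftrightarrow> m mod 4 = 0 \<or> m mod 4 = 2" by presburger
    have p: "(m + 1) mod 4 = (m mod 4 + 1) mod 4" "(m - 1) mod 4 = (m mod 4 - 1) mod 4"
      by (simp_all add: mod_simps)
    have "u (m - 1) * exp (- g) + u (m + 1) * exp g + W m * u m = 0"
      using r unfolding u_def W_def e p by auto
    then show ?thesis by (simp add: nsa_anderson_def mult.commute)
  qed
qed

section \<open>Points outside the numerical range\<close>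

lemma has_sum_shift_diff:
  fixes F :: "int \<Rightarrow> real"
  assumes "F summable_on UNIV"
  shows "((\<lambda>m. F (m + 1) - F m) has_sum 0) UNIV"
proof -
  have bij: "bij_betw (\<lambda>m::int. m + 1) UNIV UNIV"
    by (rule bij_betw_byWitness[of _ "\<lambda>m. m - 1"]) auto
  have "(F has_sum infsum F UNIV) UNIV" using assms by simp
  moreover from this have "((\<lambda>m. F (m + 1)) has_sum infsum F UNIV) UNIV"
    using has_sum_reindex_bij_betw[OF bij, of F] by simp
  ultimately have "((\<lambda>m. F (m + 1) + (- F m)) has_sum (infsum F UNIV + (- infsum F UNIV))) UNIV"
    by (intro has_sum_add) (auto simp: has_sum_uminus)
  then show ?thesis by simp
qed

lemma has_sum_diff_real:
  fixes F G :: "'a \<Rightarrow> real"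
  assumes "(F has_sum a) A" "(G has_sum b) A"
  shows "((\<lambda>x. F x - G x) has_sum (a - b)) A"
proof -
  have "((\<lambda>x. - G x) has_sum - b) A" using assms(2) by (simp add: has_sum_uminus)
  from has_sum_add[OF assms(1) this] show ?thesis by simp
qed

text \<open>By a shift of the summation index, the quadratic form of the real part of \<open>cnj \<nu> H\<close> without
  potential is \<open>\<Sum>m. Re (c * f (m + 1) * cnj (f m))\<close> with \<open>c = \<nu> exp (- g) + cnj \<nu> exp g\<close>, hence at most
  \<open>norm c * (ell2_norm f)\<^sup>2\<close>; here \<open>norm c\<close> is the support function of \<open>E\<close> in direction \<open>\<nu>\<close>. The
  index shift is carried out by a telescoping term, so that a pointwise comparison of the summands
  suffices.\<close>

lemma numerical_range_bound:
  assumes V: "\<And>m. V m \<in> complex_of_real ` {-\<mu>..\<mu>}" and f: "f \<in> ell2"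
  shows "(\<Sum>\<^sub>\<infinity>m. Re (cnj \<nu> * nsa_anderson g V f m * cnj (f m)))
     \<le> (norm (\<nu> * of_real (exp (- g)) + cnj \<nu> * of_real (exp g)) + \<bar>Re \<nu>\<bar> * \<mu>) * (ell2_norm f)\<^sup>2"
proof -
  define c where "c = \<nu> * of_real (exp (- g)) + cnj \<nu> * of_real (exp g)"
  define Q where "Q m = (norm (f m))\<^sup>2" for m
  define D where "D m = Re (\<nu> * of_real (exp (- g)) * f m * cnj (f (m - 1)))" for m
  \<comment> \<open>\<open>D\<close> accounts for the shift of the backward hopping term, and the \<open>Q\<close> part symmetrises the
    arithmetic-geometric mean estimate; only differences \<open>X (m + 1) - X m\<close> occur, and they sum
    to zero.\<close>
  define X where "X m = norm c / 2 * Q m - D m" for m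
  have Vb: "norm (V m) \<le> \<mu>" "V m = of_real (Re (V m))" "\<bar>Re (V m)\<bar> \<le> \<mu>" for m
    using V[of m] by auto
  have Q: "Q summable_on UNIV" using f by (simp add: ell2_def Q_def[abs_def])
  have "D summable_on UNIV"
    using ell2_inner_summable[OF ell2_cmult(1)[OF f, of "\<nu> * of_real (exp (- g))"] ell2_shift(1)[OF f, of "-1"]]
    by (simp add: D_def[abs_def])
  then have X: "X summable_on UNIV"
    unfolding X_def[abs_def] diff_conv_add_uminus
    using Q by (intro summable_on_add summable_on_cmult_right summable_on_uminus[THEN iffD2])
  have H: "nsa_anderson g V f \<in> ell2"
    using nsa_anderson_bounded_linear[of V \<mu> g] Vb(1) ell2_bounded_linearD(1) f by blast
  have lhs: "(\<lambda>m. Re (cnj \<nu> * nsa_anderson g V f m * cnj (f m))) summable_on UNIV"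
    by (rule ell2_inner_summable[OF ell2_cmult(1)[OF H] f])
  have "(Q has_sum (ell2_norm f)\<^sup>2) UNIV"
    using Q unfolding ell2_norm_power2 Q_def[abs_def, symmetric] by simp
  then have rhs: "((\<lambda>m. (X (m + 1) - X m) + (norm c + \<bar>Re \<nu>\<bar> * \<mu>) * Q m) has_sum
      (0 + (norm c + \<bar>Re \<nu>\<bar> * \<mu>) * (ell2_norm f)\<^sup>2)) UNIV"
    by (intro has_sum_add has_sum_shift_diff X has_sum_cmult_right)
  have le: "Re (cnj \<nu> * nsa_anderson g V f m * cnj (f m))
      \<le> (X (m + 1) - X m) + (norm c + \<bar>Re \<nu>\<bar> * \<mu>) * Q m" for m
  proof -
    have "Re (cnj \<nu> * nsa_anderson g V f m * cnj (f m)) =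
       Re (cnj \<nu> * of_real (exp (- g)) * f (m - 1) * cnj (f m)) + Re (cnj \<nu> * of_real (exp g) * f (m + 1) * cnj (f m))
       + Re (cnj \<nu> * V m * (f m * cnj (f m)))"
      by (simp add: nsa_anderson_def algebra_simps)
    moreover have "Re (cnj \<nu> * of_real (exp (- g)) * f (m - 1) * cnj (f m)) = D m"
      unfolding D_def by (simp add: algebra_simps)
    moreover have "Re (cnj \<nu> * of_real (exp g) * f (m + 1) * cnj (f m)) = Re (c * f (m + 1) * cnj (f m)) - D (m + 1)"
      by (simp add: c_def D_def algebra_simps)
    moreover have "Re (c * f (m + 1) * cnj (f m)) \<le> norm c / 2 * (Q (m + 1) + Q m)"
    proof -
      have "Re (c * f (m + 1) * cnj (f m)) \<le> norm c * (norm (f (m + 1)) * norm (f m))"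
        using complex_Re_le_cmod[of "c * f (m + 1) * cnj (f m)"] by (simp add: norm_mult mult.assoc)
      also have "\<dots> \<le> norm c * ((Q (m + 1) + Q m) / 2)"
        using sum_squares_bound[of "norm (f (m + 1))" "norm (f m)"]
        by (intro mult_left_mono) (auto simp: Q_def)
      finally show ?thesis by simp
    qed
    moreover have "Re (cnj \<nu> * V m * (f m * cnj (f m))) \<le> \<bar>Re \<nu>\<bar> * \<mu> * Q m"
    proof -
      have "Re (cnj \<nu> * V m * (f m * cnj (f m))) = Re \<nu> * Re (V m) * Q m"
        by (subst Vb(2)) (simp add: complex_norm_square[symmetric] Q_def)
      also have "\<dots> \<le> \<bar>Re \<nu>\<bar> * \<mu> * Q m"
      proof (rule mult_right_mono)
        have "Re \<nu> * Re (V m) \<le> \<bar>Re \<nu>\<bar> * \<bar>Re (V m)\<bar>" by (metis abs_ge_self abs_mult)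
        also have "\<dots> \<le> \<bar>Re \<nu>\<bar> * \<mu>" using Vb(3) by (intro mult_left_mono) auto
        finally show "Re \<nu> * Re (V m) \<le> \<bar>Re \<nu>\<bar> * \<mu>" .
      qed (simp add: Q_def)
      finally show ?thesis .
    qed
    ultimately show ?thesis by (simp add: X_def algebra_simps)
  qed
  have "(\<Sum>\<^sub>\<infinity>m. Re (cnj \<nu> * nsa_anderson g V f m * cnj (f m)))
      \<le> 0 + (norm c + \<bar>Re \<nu>\<bar> * \<mu>) * (ell2_norm f)\<^sup>2"
    using lhs rhs le by (intro has_sum_mono[OF has_sum_infsum]) auto
  then show ?thesis by (simp add: c_def)
qed

lemma ell2_norm_diff_power2:
  assumes f: "f \<in> ell2" and h: "h \<in> ell2"
  shows "(ell2_norm (\<lambda>m. f m - of_real t * h m))\<^sup>2 =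
     (ell2_norm f)\<^sup>2 - 2 * t * (\<Sum>\<^sub>\<infinity>m. Re (h m * cnj (f m))) + t\<^sup>2 * (ell2_norm h)\<^sup>2"
proof -
  have "(norm (f m - of_real t * h m))\<^sup>2 = (norm (f m))\<^sup>2 + (- 2 * t) * Re (h m * cnj (f m)) + t\<^sup>2 * (norm (h m))\<^sup>2" for m
    by (simp only: cmod_power2) (simp add: power2_eq_square algebra_simps)
  moreover have "((\<lambda>m. (norm (f m))\<^sup>2 + (- 2 * t) * Re (h m * cnj (f m)) + t\<^sup>2 * (norm (h m))\<^sup>2) has_sum
      ((ell2_norm f)\<^sup>2 + (- 2 * t) * (\<Sum>\<^sub>\<infinity>m. Re (h m * cnj (f m))) + t\<^sup>2 * (ell2_norm h)\<^sup>2)) UNIV"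
    unfolding ell2_norm_power2
    using f h ell2_inner_summable[OF h f]
    by (intro has_sum_add has_sum_cmult_right has_sum_infsum) (auto simp: ell2_def)
  ultimately show ?thesis
    unfolding ell2_norm_power2[of "\<lambda>m. f m - of_real t * h m"] by (simp add: infsumI)
qed

lemma cmult_bounded_linear: "ell2_bounded_linear (\<lambda>f m. c * f m)"
  unfolding ell2_bounded_linear_def
  by (intro conjI ballI allI exI[of _ "norm c"] ell2_cmult) (auto simp: algebra_simps)

text \<open>The hypothesis places \<open>z\<close> strictly beyond a supporting line of the numerical range, with gap
  \<open>\<delta>\<close>. Thus \<open>A = cnj \<nu> (z - H)\<close> satisfies \<open>Re \<langle>A f, f\<rangle> \<ge> \<delta> |f|\<^sup>2\<close>, and expanding the square gives
  \<open>|f - t A f|\<^sup>2 \<le> (1 - 2 t \<delta> + t\<^sup>2 C\<^sup>2) |f|\<^sup>2\<close> for any bound \<open>C\<close> on the norm of \<open>A\<close>, which is a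
  strict contraction for the minimising \<open>t = \<delta> / C\<^sup>2\<close>.\<close>

lemma half_plane_not_in_spectrum:
  assumes V: "\<And>m. V m \<in> complex_of_real ` {-\<mu>..\<mu>}"
    and sep: "norm (\<nu> * of_real (exp (- g)) + cnj \<nu> * of_real (exp g)) + \<bar>Re \<nu>\<bar> * \<mu> < Re (cnj \<nu> * z)"
  shows "z \<notin> ell2_spectrum (nsa_anderson g V)"
proof -
  have Vb: "norm (V m) \<le> \<mu>" for m using V[of m] by auto
  let ?H = "nsa_anderson g V"
  note Hbl = nsa_anderson_bounded_linear[of V \<mu> g, OF Vb]
  note Hl = ell2_bounded_linearD[OF Hbl]
  define \<delta> where "\<delta> = Re (cnj \<nu> * z) - (norm (\<nu> * of_real (exp (- g)) + cnj \<nu> * of_real (exp g)) + \<bar>Re \<nu>\<bar> * \<mu>)"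
  have \<delta>: "\<delta> > 0" using sep by (simp add: \<delta>_def)
  have \<nu>: "\<nu> \<noteq> 0" using sep by auto
  obtain C1 where C1: "\<And>f. f \<in> ell2 \<Longrightarrow> ell2_norm (?H f) \<le> C1 * ell2_norm f"
    using Hbl unfolding ell2_bounded_linear_def by blast
  \<comment> \<open>Adding \<open>\<delta>\<close> makes the squared contraction constant \<open>1 - (\<delta> / C)\<^sup>2\<close> nonnegative.\<close>
  define C where "C = norm \<nu> * (norm z + \<bar>C1\<bar>) + \<delta>"
  have C: "C \<ge> \<delta>" by (simp add: C_def)
  then have C0: "C > 0" using \<delta> by linarith
  define A where "A f = (\<lambda>m. cnj \<nu> * (z * f m - ?H f m))" for f
  have A_ell2: "A f \<in> ell2" if "f \<in> ell2" for f
    unfolding A_def by (intro ell2_cmult(1) ell2_diff(1) Hl(1) that)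
  have A_norm: "ell2_norm (A f) \<le> C * ell2_norm f" if f: "f \<in> ell2" for f
  proof -
    have "ell2_norm (A f) \<le> norm \<nu> * ell2_norm (\<lambda>m. z * f m - ?H f m)"
      unfolding A_def using ell2_cmult(2)[OF ell2_diff(1)[OF ell2_cmult(1)[OF f] Hl(1)[OF f]], of "cnj \<nu>"] by simp
    also have "\<dots> \<le> norm \<nu> * ((norm z + \<bar>C1\<bar>) * ell2_norm f)"
    proof (rule mult_left_mono)
      have "ell2_norm (\<lambda>m. z * f m - ?H f m) \<le> norm z * ell2_norm f + C1 * ell2_norm f"
        using ell2_diff(2)[OF ell2_cmult(1)[OF f] Hl(1)[OF f], of z] ell2_cmult(2)[OF f, of z] C1[OF f] by linarith
      also have "\<dots> \<le> (norm z + \<bar>C1\<bar>) * ell2_norm f"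
        using mult_right_mono[OF abs_ge_self[of C1] ell2_norm_nonneg[of f]] by (simp add: distrib_right)
      finally show "ell2_norm (\<lambda>m. z * f m - ?H f m) \<le> (norm z + \<bar>C1\<bar>) * ell2_norm f" .
    qed simp
    also have "\<dots> \<le> C * ell2_norm f"
      using \<delta> ell2_norm_nonneg[of f] unfolding C_def by (simp add: distrib_right mult.assoc)
    finally show ?thesis .
  qed
  have A_acc: "\<delta> * (ell2_norm f)\<^sup>2 \<le> (\<Sum>\<^sub>\<infinity>m. Re (A f m * cnj (f m)))" if f: "f \<in> ell2" for f
  proof -
    have pt: "Re (A f m * cnj (f m)) = Re (cnj \<nu> * z) * (norm (f m))\<^sup>2 - Re (cnj \<nu> * ?H f m * cnj (f m))" for m
    proof -
      have "A f m * cnj (f m) = (cnj \<nu> * z) * of_real ((norm (f m))\<^sup>2) - cnj \<nu> * ?H f m * cnj (f m)"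
        by (simp only: complex_norm_square A_def) (simp add: algebra_simps)
      then show ?thesis by simp
    qed
    have "(\<Sum>\<^sub>\<infinity>m. Re (cnj \<nu> * z) * (norm (f m))\<^sup>2 - Re (cnj \<nu> * ?H f m * cnj (f m))) =
       Re (cnj \<nu> * z) * (ell2_norm f)\<^sup>2 - (\<Sum>\<^sub>\<infinity>m. Re (cnj \<nu> * ?H f m * cnj (f m)))"
      unfolding ell2_norm_power2
      using f unfolding ell2_def
      by (intro infsumI has_sum_diff_real has_sum_cmult_right has_sum_infsum
          ell2_inner_summable[OF ell2_cmult(1)[OF Hl(1)[OF f]] f]) simp
    moreover have "\<delta> * (ell2_norm f)\<^sup>2 = Re (cnj \<nu> * z) * (ell2_norm f)\<^sup>2 -
        (norm (\<nu> * of_real (exp (- g)) + cnj \<nu> * of_real (exp g)) + \<bar>Re \<nu>\<bar> * \<mu>) * (ell2_norm f)\<^sup>2"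
      unfolding \<delta>_def by (rule left_diff_distrib)
    ultimately show ?thesis
      using numerical_range_bound[of V \<mu>, OF V f, of \<nu> g] unfolding pt by linarith
  qed
  define t where "t = \<delta> / C\<^sup>2"
  have t: "t > 0" using \<delta> C0 by (simp add: t_def)
  define q where "q = sqrt (1 - \<delta>\<^sup>2 / C\<^sup>2)"
  have dC: "0 < \<delta>\<^sup>2 / C\<^sup>2" "\<delta>\<^sup>2 / C\<^sup>2 \<le> 1"
    using \<delta> C C0 power_mono[of \<delta> C 2] by simp_all
  have q: "0 \<le> q" "q < 1" using dC by (auto simp: q_def)
  have contr: "ell2_norm (\<lambda>m. f m - of_real t * A f m) \<le> q * ell2_norm f" if f: "f \<in> ell2" for f
  proof (rule power2_le_imp_le)
    have "(ell2_norm (\<lambda>m. f m - of_real t * A f m))\<^sup>2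
        \<le> (ell2_norm f)\<^sup>2 - 2 * t * (\<delta> * (ell2_norm f)\<^sup>2) + t\<^sup>2 * (C * ell2_norm f)\<^sup>2"
      unfolding ell2_norm_diff_power2[OF f A_ell2[OF f]]
      using A_acc[OF f] A_norm[OF f] t ell2_norm_nonneg
      by (intro add_mono diff_mono mult_left_mono power_mono) auto
    also have "\<dots> = (1 - \<delta>\<^sup>2 / C\<^sup>2) * (ell2_norm f)\<^sup>2"
      using C0 by (simp add: t_def field_simps power2_eq_square)
    also have "\<dots> = (q * ell2_norm f)\<^sup>2" using dC by (simp add: q_def power_mult_distrib)
    finally show "(ell2_norm (\<lambda>m. f m - of_real t * A f m))\<^sup>2 \<le> (q * ell2_norm f)\<^sup>2" .
  qed (use q ell2_norm_nonneg in auto)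
  show ?thesis
  proof (rule not_in_spectrum_preconditioned[OF Hbl cmult_bounded_linear[of "- of_real t * cnj \<nu>"] _ _ q])
    show "f = (\<lambda>_. 0)" if "(\<lambda>m. - of_real t * cnj \<nu> * f m) = (\<lambda>_. 0)" for f
      using that t \<nu> by (auto simp: fun_eq_iff)
    show "ell2_norm (\<lambda>m. f m - - of_real t * cnj \<nu> * (?H f m - z * f m)) \<le> q * ell2_norm f"
      if "f \<in> ell2" for f
      using contr[OF that] by (simp add: A_def algebra_simps)
    show "(\<lambda>n. - of_real t * cnj \<nu> * (?H (X n) m - z * X n m)) \<longlonglongrightarrow> - of_real t * cnj \<nu> * (?H f m - z * f m)"
      if "\<And>j. (\<lambda>n. X n j) \<longlonglongrightarrow> f j" for X f m
      unfolding nsa_anderson_def by (intro tendsto_intros that)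
  qed
qed

text \<open>The preconditioner is the inverse of the forward hopping term \<open>exp g * f (m + 1)\<close>; the remaining
  terms, of norm at most \<open>exp (- g) + \<mu>\<close>, are smaller than \<open>exp g\<close>.\<close>

lemma zero_not_in_spectrum:
  assumes Vb: "\<And>m. norm (V m) \<le> \<mu>" and \<mu>: "\<mu> < exp g - exp (- g)"
  shows "0 \<notin> ell2_spectrum (nsa_anderson g V)"
proof -
  have \<mu>0: "\<mu> \<ge> 0" using Vb[of 0] norm_ge_zero order_trans by blast
  let ?H = "nsa_anderson g V"
  note Hbl = nsa_anderson_bounded_linear[of V \<mu> g, OF Vb]
  let ?B = "\<lambda>f m. of_real (exp (- g)) * f (m - 1 :: int) :: complex"
  have B: "ell2_bounded_linear ?B"
    unfolding ell2_bounded_linear_def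
  proof (intro conjI ballI allI exI)
    fix f assume f: "f \<in> ell2"
    note * = ell2_cmult[OF ell2_shift(1)[OF f, of "-1"], of "of_real (exp (- g))"] ell2_shift(2)[OF f, of "-1"]
    show "?B f \<in> ell2" using *(1) by simp
    show "ell2_norm (?B f) \<le> exp (- g) * ell2_norm f" using * by simp
  qed (auto simp: algebra_simps)
  define q where "q = exp (- g) * (exp (- g) + \<mu>)"
  have "q < exp (- g) * exp g" unfolding q_def using \<mu> by (intro mult_strict_left_mono) auto
  then have q: "0 \<le> q" "q < 1" using \<mu>0 by (auto simp: q_def exp_minus)
  show ?thesis
  proof (rule not_in_spectrum_preconditioned[OF Hbl B _ _ q])
    show "f = (\<lambda>_. 0)" if "?B f = (\<lambda>_. 0)" for f
    proof
      fix m show "f m = 0" using fun_cong[OF that, of "m + 1"] by simp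
    qed
    show "(\<lambda>n. ?B (\<lambda>m. ?H (X n) m - 0 * X n m) m) \<longlonglongrightarrow> ?B (\<lambda>m. ?H f m - 0 * f m) m"
      if "\<And>j. (\<lambda>n. X n j) \<longlonglongrightarrow> f j" for X f m
      unfolding nsa_anderson_def by (intro tendsto_intros that)
    fix f assume f: "f \<in> ell2"
    define h where "h m = of_real (exp (- g)) * f (m - 1) + 0 * f (m + 1) + V m * f m" for m
    have h: "h \<in> ell2" "ell2_norm h \<le> (exp (- g) + \<mu>) * ell2_norm f"
      using ell2_tridiagonal[OF f \<mu>0, of V "of_real (exp (- g))" 0] Vb
      by (auto simp: h_def[abs_def])
    have "of_real (exp (- g)) * (of_real (exp g) :: complex) = 1"
      by (metis exp_minus_inverse mult.commute of_real_1 of_real_mult)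
    then have "(\<lambda>m. f m - ?B (\<lambda>m. ?H f m - 0 * f m) m) = (\<lambda>m. (- of_real (exp (- g))) * h (m + -1))"
      by (auto simp: nsa_anderson_def h_def fun_eq_iff distrib_left mult.assoc[symmetric])
    moreover have "ell2_norm (\<lambda>m. (- of_real (exp (- g))) * h (m + -1)) \<le> exp (- g) * ell2_norm h"
      using ell2_cmult(2)[OF ell2_shift(1)[OF h(1), of "-1"], of "- of_real (exp (- g))"]
        ell2_shift(2)[OF h(1), of "-1"] by simp
    moreover have "exp (- g) * ell2_norm h \<le> q * ell2_norm f"
      using h(2) by (simp add: q_def mult.assoc)
    ultimately show "ell2_norm (\<lambda>m. f m - ?B (\<lambda>m. ?H f m - 0 * f m) m) \<le> q * ell2_norm f" by simp
  qed
qed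

section \<open>Geometry of the ellipse\<close>

lemma ellipse_E_iff:
  assumes "g > 0"
  shows "z \<in> ellipse_E g \<longleftrightarrow>
    (Re z / (exp g + exp (- g)))\<^sup>2 + (Im z / (exp g - exp (- g)))\<^sup>2 = 1"
proof -
  define a b where "a = exp g + exp (- g)" and "b = exp g - exp (- g)"
  have ab: "a > 0" "b > 0" using assms by (auto simp: a_def b_def add_pos_pos)
  have pt: "exp (of_real g + \<i> * of_real \<theta>) + exp (- of_real g - \<i> * of_real \<theta>) =
      Complex (a * cos \<theta>) (b * sin \<theta>)" for \<theta>
    by (simp add: complex_eq_iff Re_exp Im_exp a_def b_def algebra_simps)
  show ?thesis
  proof
    assume "z \<in> ellipse_E g"
    then obtain \<theta> where "z = Complex (a * cos \<theta>) (b * sin \<theta>)" by (auto simp: ellipse_E_def pt)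
    then show "(Re z / (exp g + exp (- g)))\<^sup>2 + (Im z / (exp g - exp (- g)))\<^sup>2 = 1"
      using ab by (simp add: a_def[symmetric] b_def[symmetric])
  next
    assume "(Re z / (exp g + exp (- g)))\<^sup>2 + (Im z / (exp g - exp (- g)))\<^sup>2 = 1"
    then obtain \<theta> where "0 \<le> \<theta>" "\<theta> < 2 * pi" "Re z / a = cos \<theta>" "Im z / b = sin \<theta>"
      using sincos_total_2pi unfolding a_def b_def by metis
    then have "z = Complex (a * cos \<theta>) (b * sin \<theta>)"
      using ab by (simp add: complex_eq_iff field_simps)
    then show "z \<in> ellipse_E g" 
      using \<open>0 \<le> \<theta>\<close> \<open>\<theta> < 2 * pi\<close> unfolding ellipse_E_def pt by force
  qed
qed

text \<open>On a horizontal line at height \<open>y\<close> with \<open>|y| \<le> b\<close>, the ellipse has the two points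
  \<open>\<plusminus> a w + i y\<close> with \<open>w \<le> 1\<close>. The segments of half-length \<open>\<mu> \<ge> a\<close> around them overlap, so that they cover
  all of \<open>|x| \<le> \<mu> + a w\<close>. A point \<open>z\<close> outside therefore moves, when shifted by \<open>\<mu>\<close> towards the
  imaginary axis, to a point that is still outside the ellipse; the gradient there of
  \<open>(x / a)\<^sup>2 + (y / b)\<^sup>2\<close> is the direction sought. For \<open>|y| > b\<close> a vertical direction separates.\<close>

lemma separating_direction:
  assumes g: "g > 0" and \<mu>: "\<mu> \<ge> exp g + exp (- g)"
    and z: "z \<notin> ellipse_E g + complex_of_real ` {-\<mu>..\<mu>}"
  shows "\<exists>\<nu>. norm (\<nu> * of_real (exp (- g)) + cnj \<nu> * of_real (exp g)) + \<bar>Re \<nu>\<bar> * \<mu> < Re (cnj \<nu> * z)"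
proof -
  define a b where "a = exp g + exp (- g)" and "b = exp g - exp (- g)"
  have ab: "a > 0" "b > 0" "\<mu> \<ge> a" using g \<mu> by (auto simp: a_def b_def add_pos_pos)
  have supp: "norm (\<nu> * of_real (exp (- g)) + cnj \<nu> * of_real (exp g)) = sqrt ((a * Re \<nu>)\<^sup>2 + (b * Im \<nu>)\<^sup>2)" for \<nu>
    by (simp add: cmod_def a_def b_def power2_eq_square algebra_simps)
  show ?thesis
  proof (cases "\<bar>Im z\<bar> \<le> b")
    case False
    then show ?thesis
      using ab by (intro exI[of _ "\<i> * of_real (sgn (Im z))"], subst supp)
        (auto simp: sgn_if abs_if split: if_splits)
  next
    case True
    define w where "w = sqrt (1 - (Im z / b)\<^sup>2)"
    have "\<bar>Im z / b\<bar> \<le> 1" using True ab by simp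
    then have "(Im z / b)\<^sup>2 \<le> 1" by (simp add: abs_square_le_1)
    then have w: "0 \<le> w" "w\<^sup>2 = 1 - (Im z / b)\<^sup>2" "w \<le> 1" by (auto simp: w_def)
    have in_E: "Complex (s * a * w) (Im z) \<in> ellipse_E g" if "s = 1 \<or> s = - 1" for s
      unfolding ellipse_E_iff[OF g] a_def[symmetric] b_def[symmetric]
      using that w ab by (auto simp: power_divide)
    have not: "\<bar>Re z - s * a * w\<bar> > \<mu>" if "s = 1 \<or> s = - 1" for s
    proof (rule ccontr)
      assume "\<not> \<mu> < \<bar>Re z - s * a * w\<bar>"
      then have "Complex (s * a * w) (Im z) + of_real (Re z - s * a * w)
          \<in> ellipse_E g + complex_of_real ` {-\<mu>..\<mu>}"
        by (intro set_plus_intro in_E that imageI) auto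
      moreover have "Complex (s * a * w) (Im z) + of_real (Re z - s * a * w) = z"
        by (simp add: complex_eq_iff)
      ultimately show False using z by simp
    qed
    have aw: "a * w \<le> \<mu>" "0 \<le> a * w"
    proof -
      have "a * w \<le> a * 1" using w(3) ab by (intro mult_left_mono) auto
      then show "a * w \<le> \<mu>" using ab(3) unfolding mult_1_right by linarith
      show "0 \<le> a * w" using w ab by simp
    qed
    have far: "\<bar>Re z\<bar> - \<mu> > a * w"
      using not[of 1] not[of "-1"] aw by (auto simp: abs_if split: if_splits)
    \<comment> \<open>By symmetry in the imaginary axis the shifted point is taken to be \<open>p + i y\<close> with \<open>p > 0\<close>; the
      quadratic form has value \<open>Q > 1\<close> there and the support function of the ellipse at \<open>\<nu>\<close> is \<open>sqrt Q\<close>.\<close>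
    define p where "p = \<bar>Re z\<bar> - \<mu>"
    define \<nu> where "\<nu> = Complex (sgn (Re z) * p / a\<^sup>2) (Im z / b\<^sup>2)"
    define Q where "Q = (p / a)\<^sup>2 + (Im z / b)\<^sup>2"
    have p: "p > a * w" "p > 0" using far aw by (auto simp: p_def)
    have sg: "sgn (Re z) * sgn (Re z) = 1" "\<bar>sgn (Re z)\<bar> = 1" "sgn (Re z) * Re z = \<bar>Re z\<bar>"
      using p ab aw by (auto simp: sgn_if p_def split: if_splits)
    have "w < p / a" using p ab by (simp add: field_simps)
    then have "w\<^sup>2 < (p / a)\<^sup>2" using w by (intro power_strict_mono) auto
    then have Q: "Q > 1" using w by (simp add: Q_def)
    have "(a * Re \<nu>)\<^sup>2 + (b * Im \<nu>)\<^sup>2 = Q"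
    proof -
      have "(a * Re \<nu>)\<^sup>2 = (p / a)\<^sup>2" 
        using ab sg(1) by (simp add: \<nu>_def power2_eq_square field_simps)
      moreover have "(b * Im \<nu>)\<^sup>2 = (Im z / b)\<^sup>2"
        using ab by (simp add: \<nu>_def power2_eq_square field_simps)
      ultimately show ?thesis by (simp add: Q_def)
    qed
    moreover have "sqrt Q < Q" 
    proof (rule real_less_lsqrt)
      show "0 \<le> Q" using Q by simp
      show "Q < Q\<^sup>2" using Q mult_strict_left_mono[of 1 Q Q] by (simp add: power2_eq_square)
    qed
    moreover have "Re (cnj \<nu> * z) = Q + \<bar>Re \<nu>\<bar> * \<mu>"
    proof -
      have "\<bar>Re \<nu>\<bar> = p / a\<^sup>2" using sg p by (simp add: \<nu>_def abs_mult)
      moreover have "Re \<nu> * Re z = p / a\<^sup>2 * \<bar>Re z\<bar>"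
        using sg(3) by (simp add: \<nu>_def)
      moreover have "\<bar>Re z\<bar> = p + \<mu>" by (simp add: p_def)
      moreover have "Im \<nu> * Im z = (Im z / b)\<^sup>2" by (simp add: \<nu>_def power2_eq_square)
      moreover have "p / a\<^sup>2 * p = (p / a)\<^sup>2" by (simp add: power2_eq_square)
      ultimately show ?thesis by (simp add: Q_def distrib_left)
    qed
    ultimately show ?thesis by (intro exI[of _ \<nu>], subst supp) auto
  qed
qed

theorem theorem13:
  fixes g \<mu> :: real and V :: "int \<Rightarrow> complex"
  assumes "g > 0" and "\<mu> \<ge> 0"
    and "pseudo_ergodic (complex_of_real ` {-\<mu>..\<mu>}) V"
  shows "(\<mu> \<ge> exp g + exp (- g) \<longrightarrow>
            ell2_spectrum (nsa_anderson g V) = ellipse_E g + complex_of_real ` {-\<mu>..\<mu>}) \<and>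
         (0 \<in> ell2_spectrum (nsa_anderson g V) \<longleftrightarrow> \<mu> \<ge> exp g - exp (- g))"
proof (intro conjI impI)
  have V: "V m \<in> complex_of_real ` {-\<mu>..\<mu>}" for m
    using assms(3) unfolding pseudo_ergodic_def by auto
  have Vb: "norm (V m) \<le> \<mu>" for m using V[of m] by auto
  show "ell2_spectrum (nsa_anderson g V) = ellipse_E g + complex_of_real ` {-\<mu>..\<mu>}"
    if "\<mu> \<ge> exp g + exp (- g)"
    using separating_direction[OF assms(1) that] half_plane_not_in_spectrum[of V \<mu>, OF V]
      ellipse_plus_range_subset_spectrum[OF assms(3)] by blast
  show "0 \<in> ell2_spectrum (nsa_anderson g V) \<longleftrightarrow> \<mu> \<ge> exp g - exp (- g)"
  proof
    show "\<mu> \<ge> exp g - exp (- g)" if "0 \<in> ell2_spectrum (nsa_anderson g V)"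
      using that zero_not_in_spectrum[of V \<mu>, OF Vb] by force
    show "0 \<in> ell2_spectrum (nsa_anderson g V)" if "\<mu> \<ge> exp g - exp (- g)"
    proof (rule zero_in_spectrum[OF assms(3)])
      have "exp g - exp (- g) \<ge> 0" using assms(1) by simp
      with that have "exp g - exp (- g) \<in> {-\<mu>..\<mu>}" "- (exp g - exp (- g)) \<in> {-\<mu>..\<mu>}"
        using assms(2) unfolding atLeastAtMost_iff by linarith+
      then show "of_real (exp g - exp (- g)) \<in> complex_of_real ` {-\<mu>..\<mu>}"
        "of_real (- (exp g - exp (- g))) \<in> complex_of_real ` {-\<mu>..\<mu>}"
        by - (rule imageI, assumption)+
    qed
  qed
qed

end
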